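(* Let $(H,d)$ be a locally compact Hadamard space. Then the weak topology $\tau_w$ on $H$ and the strong (metric) topology on $H$ coincide.
   Context: A Hadamard space is a complete $\mathrm{CAT}(0)$ space. Local compactness refers to the metric topology: every point $x$ lies in an open set that is contained in a compact set. For $x\in H$, $\Gamma_x(H)$ is the set of all constant speed geodesics $\gamma:[0,1]\to H$ (i.e. $d(\gamma(s),\gamma(t))=|s-t|\,d(\gamma(0),\gamma(1))$ for all $s,t\in[0,1]$) with $\gamma(0)=x$. For a geodesic $\gamma$, $P_\gamma$ denotes the metric projection onto (the image of) $\gamma$. For $x\in H$, $\gamma_1,\dots,\gamma_n\in\Gamma_x(H)$, $\varepsilon>0$, let $U_x(\varepsilon;\gamma_1,\dots,\gamma_n):=\{y\in H: d(x,P_{\gamma_i}y)<\varepsilon,\ i=1,\dots,n\}$. Weak topology $\tau_w$: a set $U\subset H$ is weakly open if for every $x\in U$ there exist $\varepsilon>0$ and finitely many $\gamma_1,\dots,\gamma_n\in\Gamma_x(H)$ with $U_x(\varepsilon;\gamma_1,\dots,\gamma_n)\subseteq U$. The weakly open sets (together with $\emptyset$) form the topology $\tau_w$ on $H$. *)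

theory Defs
  imports "HOL-Analysis.Analysis"
begin

context Metric_space
begin

text \<open>Constant speed geodesics \<open>[0,1] \<rightarrow> M\<close>; values outside \<open>[0,1]\<close> are irrelevant.\<close>

definition geodesic :: "(real \<Rightarrow> 'a) \<Rightarrow> bool" where
  "geodesic \<gamma> \<longleftrightarrow> \<gamma> \<in> {0..1} \<rightarrow> M \<and>
     (\<forall>s\<in>{0..1}. \<forall>t\<in>{0..1}. d (\<gamma> s) (\<gamma> t) = \<bar>s - t\<bar> * d (\<gamma> 0) (\<gamma> 1))"

definition geodesics_from :: "'a \<Rightarrow> (real \<Rightarrow> 'a) set" where
  "geodesics_from x = {\<gamma>. geodesic \<gamma> \<and> \<gamma> 0 = x}"

text \<open>In a Hadamard space the nearest point exists and is unique, so the description is proper.\<close>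

definition metric_projection :: "(real \<Rightarrow> 'a) \<Rightarrow> 'a \<Rightarrow> 'a" where
  "metric_projection \<gamma> y = (THE p. p \<in> \<gamma> ` {0..1} \<and> (\<forall>q\<in>\<gamma> ` {0..1}. d y p \<le> d y q))"

definition weak_nbhd :: "'a \<Rightarrow> real \<Rightarrow> (real \<Rightarrow> 'a) set \<Rightarrow> 'a set" where
  "weak_nbhd x \<epsilon> F = {y \<in> M. \<forall>\<gamma>\<in>F. d x (metric_projection \<gamma> y) < \<epsilon>}"

definition weakly_open :: "'a set \<Rightarrow> bool" where
  "weakly_open U \<longleftrightarrow> U \<subseteq> M \<and>
     (\<forall>x\<in>U. \<exists>\<epsilon>>0. \<exists>F. finite F \<and> F \<subseteq> geodesics_from x \<and> weak_nbhd x \<epsilon> F \<subseteq> U)"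

definition weak_topology :: "'a topology" where
  "weak_topology = topology weakly_open"

lemma istopology_weakly_open: "istopology weakly_open"
  unfolding istopology_def
proof (intro conjI allI impI)
  fix U V assume U: "weakly_open U" and V: "weakly_open V"
  show "weakly_open (U \<inter> V)"
    unfolding weakly_open_def
  proof (intro conjI ballI)
    show "U \<inter> V \<subseteq> M" using U by (auto simp: weakly_open_def)
    fix x assume x: "x \<in> U \<inter> V"
    obtain e F where e: "e > 0" "finite F" "F \<subseteq> geodesics_from x" "weak_nbhd x e F \<subseteq> U"
      using U x unfolding weakly_open_def by blast
    obtain e' F' where e': "e' > 0" "finite F'" "F' \<subseteq> geodesics_from x" "weak_nbhd x e' F' \<subseteq> V"
      using V x unfolding weakly_open_def by blast
    have "weak_nbhd x (min e e') (F \<union> F') \<subseteq> weak_nbhd x e F \<inter> weak_nbhd x e' F'"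
      by (auto simp: weak_nbhd_def)
    then have "weak_nbhd x (min e e') (F \<union> F') \<subseteq> U \<inter> V"
      using e(4) e'(4) by blast
    moreover have "min e e' > 0" "finite (F \<union> F')" "F \<union> F' \<subseteq> geodesics_from x"
      using e e' by auto
    ultimately show "\<exists>\<epsilon>>0. \<exists>F. finite F \<and> F \<subseteq> geodesics_from x \<and> weak_nbhd x \<epsilon> F \<subseteq> U \<inter> V"
      by blast
  qed
next
  fix K assume K: "\<forall>U\<in>K. weakly_open U"
  show "weakly_open (\<Union>K)"
    unfolding weakly_open_def
  proof (intro conjI ballI)
    show "\<Union>K \<subseteq> M" using K by (auto simp: weakly_open_def)
    fix x assume "x \<in> \<Union>K"
    then obtain U where U: "U \<in> K" "x \<in> U" by blast
    then obtain e F where "e > 0" "finite F" "F \<subseteq> geodesics_from x" "weak_nbhd x e F \<subseteq> U"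
      using K unfolding weakly_open_def by blast
    with U(1) show "\<exists>\<epsilon>>0. \<exists>F. finite F \<and> F \<subseteq> geodesics_from x \<and> weak_nbhd x \<epsilon> F \<subseteq> \<Union>K"
      by blast
  qed
qed

lemma openin_weak_topology: "openin weak_topology = weakly_open"
  unfolding weak_topology_def by (simp add: istopology_weakly_open)

lemma topspace_weak_topology: "topspace weak_topology = M"
proof
  show "topspace weak_topology \<subseteq> M"
    using openin_topspace[of weak_topology] by (simp add: openin_weak_topology weakly_open_def)
  have "weakly_open M"
    unfolding weakly_open_def
  proof (intro conjI ballI)
    fix x
    have "finite {} \<and> {} \<subseteq> geodesics_from x \<and> weak_nbhd x 1 {} \<subseteq> M"
      by (auto simp: weak_nbhd_def)
    then show "\<exists>\<epsilon>>0. \<exists>F. finite F \<and> F \<subseteq> geodesics_from x \<and> weak_nbhd x \<epsilon> F \<subseteq> M"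
      using zero_less_one by blast
  qed simp
  then show "M \<subseteq> topspace weak_topology"
    by (simp add: openin_subset openin_weak_topology)
qed

end

text \<open>
  In \<open>comparison\<close> the three vertices are \<open>v 0, v 1, v 2\<close>, the side \<open>g i\<close> joins \<open>v i\<close> to
  \<open>v ((i + 1) mod 3)\<close>, and \<open>w 0, w 1, w 2\<close> are the vertices of a comparison triangle in the
  Euclidean plane.  The comparison point of \<open>g i s\<close> is the point with parameter \<open>s\<close> on the
  corresponding straight side.
\<close>

locale CAT0_space = Metric_space +
  assumes geodesic_exists:
    "\<lbrakk>x \<in> M; y \<in> M\<rbrakk> \<Longrightarrow> \<exists>\<gamma>. geodesic \<gamma> \<and> \<gamma> 0 = x \<and> \<gamma> 1 = y"
  and comparison:
    "\<And>(v :: nat \<Rightarrow> 'a) (g :: nat \<Rightarrow> real \<Rightarrow> 'a) (w :: nat \<Rightarrow> real^2) i j s t.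
      \<lbrakk>\<And>k. k < 3 \<Longrightarrow> geodesic (g k) \<and> g k 0 = v k \<and> g k 1 = v ((k + 1) mod 3);
       \<And>k. k < 3 \<Longrightarrow> dist (w k) (w ((k + 1) mod 3)) = d (v k) (v ((k + 1) mod 3));
       i < 3; j < 3; s \<in> {0..1}; t \<in> {0..1}\<rbrakk>
      \<Longrightarrow> d (g i s) (g j t)
          \<le> dist (linepath (w i) (w ((i + 1) mod 3)) s) (linepath (w j) (w ((j + 1) mod 3)) t)"

locale Hadamard_space = CAT0_space +
  assumes complete: mcomplete

end

theory Submission
  imports Defs
begin

text \<open>
  Everything reduces to two triangle inequalities for the projection \<open>p\<close> of \<open>y\<close> to a
  geodesic \<open>\<gamma>\<close> issuing from \<open>x\<close>, both based on \<open>p\<close> being a point of \<open>\<gamma>\<close> nearest to \<open>y\<close>.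

  As \<open>x\<close> lies on \<open>\<gamma>\<close>, \<open>d y p \<le> d y x\<close>, and so \<open>d x p \<le> 2 * d x y\<close>: weak neighbourhoods
  contain metric balls (\<open>mball_subset_weak_nbhd\<close>).

  Conversely, let a ball about \<open>x\<close> of radius greater than \<open>\<rho>\<close> lie in a compact set, and
  take the geodesics from \<open>x\<close> to the points of a finite \<open>\<rho>/2\<close>-net of that set.  If
  \<open>d x y \<ge> \<rho>\<close>, the point \<open>z\<close> at distance \<open>\<rho>\<close> from \<open>x\<close> on a geodesic from \<open>x\<close> to \<open>y\<close> is
  within \<open>\<rho>/2\<close> of a net point \<open>q\<close>.  Moving from \<open>x\<close> to \<open>q\<close> therefore brings one closer to
  \<open>y\<close> by more than \<open>\<rho>/2\<close>, and the projection \<open>p\<close> of \<open>y\<close> to the geodesic ending in \<open>q\<close> is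
  at least as close to \<open>y\<close> as \<open>q\<close> is.  Thus \<open>d x p > \<rho>/2\<close>, and a weak neighbourhood of
  radius \<open>\<rho>/2\<close> lies in the ball of radius \<open>\<rho>\<close>
  (\<open>weak_nbhd_subset_mball_if_locally_compact\<close>).

  The curvature bound enters only in showing that nearest points are unique, so that the
  definite description in \<open>metric_projection\<close> denotes one: at the midpoint of two distinct
  nearest points, comparison with an isosceles triangle gives a strictly smaller distance.
\<close>

section \<open>Geodesics in metric spaces\<close>

context Metric_space
begin

lemma geodesic_in_space: "geodesic \<gamma> \<Longrightarrow> t \<in> {0..1} \<Longrightarrow> \<gamma> t \<in> M"
  by (auto simp: geodesic_def)

lemma geodesic_dist:
  "geodesic \<gamma> \<Longrightarrow> s \<in> {0..1} \<Longrightarrow> t \<in> {0..1} \<Longrightarrow> d (\<gamma> s) (\<gamma> t) = \<bar>s - t\<bar> * d (\<gamma> 0) (\<gamma> 1)"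
  unfolding geodesic_def by blast

lemma geodesic_subpath:
  assumes \<gamma>: "geodesic \<gamma>" and a: "a \<in> {0..1}" and b: "b \<in> {0..1}"
  shows "geodesic (\<lambda>t. \<gamma> (linepath a b t))"
proof -
  have in01: "linepath a b t \<in> {0..1}" if "t \<in> {0..1}" for t
    using closed_segment_subset[OF a b convex_real_interval(5)] linepath_in_path[OF that, of a b]
    by blast
  have "d (\<gamma> (linepath a b s)) (\<gamma> (linepath a b t)) = \<bar>s - t\<bar> * d (\<gamma> a) (\<gamma> b)"
    if "s \<in> {0..1}" "t \<in> {0..1}" for s t
  proof -
    have "linepath a b s - linepath a b t = (s - t) * (b - a)"
      by (simp add: linepath_def algebra_simps)
    then show ?thesis
      using geodesic_dist[OF \<gamma> in01 in01] that geodesic_dist[OF \<gamma> a b]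
      by (simp add: abs_mult abs_minus_commute)
  qed
  then show ?thesis
    using geodesic_in_space[OF \<gamma> in01] by (auto simp: geodesic_def linepath_0' linepath_1')
qed

lemma geodesic_point_at_distance:
  assumes \<gamma>: "geodesic \<gamma>" and r: "0 < r" "r \<le> d (\<gamma> 0) (\<gamma> 1)"
  obtains z where "z \<in> M" "d (\<gamma> 0) z = r" "d z (\<gamma> 1) = d (\<gamma> 0) (\<gamma> 1) - r"
proof
  let ?L = "d (\<gamma> 0) (\<gamma> 1)"
  have t: "r / ?L \<in> {0..1}" using r by auto
  show "\<gamma> (r / ?L) \<in> M" using geodesic_in_space[OF \<gamma> t] .
  show "d (\<gamma> 0) (\<gamma> (r / ?L)) = r"
    using geodesic_dist[OF \<gamma> _ t, of 0] r by simp
  show "d (\<gamma> (r / ?L)) (\<gamma> 1) = ?L - r"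
    using geodesic_dist[OF \<gamma> t, of 1] r t by (simp add: left_diff_distrib)
qed

text \<open>Geodesics are Lipschitz, so the distance to a point attains its minimum over \<open>[0,1]\<close>.\<close>

lemma geodesic_nearest_point_exists:
  assumes \<gamma>: "geodesic \<gamma>" and y: "y \<in> M"
  shows "\<exists>p\<in>\<gamma> ` {0..1}. \<forall>q\<in>\<gamma> ` {0..1}. d y p \<le> d y q"
proof -
  have "(d (\<gamma> 0) (\<gamma> 1))-lipschitz_on {0..1} (\<lambda>t. d y (\<gamma> t))"
  proof (rule lipschitz_onI)
    fix s t :: real assume s: "s \<in> {0..1}" and t: "t \<in> {0..1}"
    have "\<bar>d y (\<gamma> s) - d y (\<gamma> t)\<bar> \<le> d (\<gamma> s) (\<gamma> t)"
      using geodesic_in_space[OF \<gamma> s] geodesic_in_space[OF \<gamma> t] y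
      by (smt (verit) commute triangle)
    then show "dist (d y (\<gamma> s)) (d y (\<gamma> t)) \<le> d (\<gamma> 0) (\<gamma> 1) * dist s t"
      using geodesic_dist[OF \<gamma> s t] by (simp add: dist_real_def mult.commute)
  qed simp
  then have "continuous_on {0..1} (\<lambda>t. d y (\<gamma> t))"
    by (rule lipschitz_on_continuous_on)
  then show ?thesis
    using continuous_attains_inf[of "{0..1::real}" "\<lambda>t. d y (\<gamma> t)"] by auto
qed

end

section \<open>Projections onto geodesics\<close>

context CAT0_space
begin

text \<open>
  In the comparison triangle with base \<open>p q\<close> and equal legs \<open>d y p\<close>, the median from the apex
  is an altitude, so its length is given by Pythagoras.
\<close>

lemma midpoint_of_equidistant_points:
  assumes y: "y \<in> M" and g: "geodesic g" and eq: "d y (g 0) = d y (g 1)"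
  shows "(d y (g (1/2)))\<^sup>2 \<le> (d y (g 0))\<^sup>2 - (d (g 0) (g 1))\<^sup>2 / 4"
proof -
  define p q where "p = g 0" and "q = g 1"
  have p: "p \<in> M" and q: "q \<in> M"
    using geodesic_in_space[OF g] by (auto simp: p_def q_def)
  obtain a where a: "geodesic a" "a 0 = y" "a 1 = p" using geodesic_exists[OF y p] by blast
  obtain b where b: "geodesic b" "b 0 = q" "b 1 = y" using geodesic_exists[OF q y] by blast
  define m c where "m = d y p" and "c = d p q"
  have m: "d y p = m" "d q y = m"
    using eq by (simp_all add: m_def p_def q_def commute)
  have c0: "0 \<le> c" by (simp add: c_def)
  have "c \<le> 2 * m"
    using triangle[OF p y q] m by (simp add: c_def commute)
  then have "c\<^sup>2 \<le> (2 * m)\<^sup>2" using c0 by (rule power_mono)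
  then have h0: "0 \<le> m\<^sup>2 - c\<^sup>2 / 4" by (simp add: power_mult_distrib)
  have m0: "0 \<le> m" by (simp add: m_def)
  define h where "h = sqrt (m\<^sup>2 - c\<^sup>2 / 4)"
  have h2: "h\<^sup>2 = m\<^sup>2 - c\<^sup>2 / 4" and hpos: "0 \<le> h" using h0 by (simp_all add: h_def)
  define v where "v k = (if k = 0 then y else if k = 1 then p else q)" for k :: nat
  define G where "G k = (if k = 0 then a else if k = 1 then g else b)" for k :: nat
  define w :: "nat \<Rightarrow> real^2" where
    "w k = (if k = 0 then vector [0, h] else if k = 1 then vector [- (c/2), 0] else vector [c/2, 0])" for k
  have leg: "sqrt ((c/2)\<^sup>2 + h\<^sup>2) = m"
    using m0 h2 by (simp add: power_divide)
  have w: "dist (w 0) (w 1) = m" "dist (w 1) (w 2) = c" "dist (w 2) (w 0) = m"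
    using leg c0 by (simp_all add: w_def dist_vec_def L2_set_def sum_2 dist_real_def)
  have mid: "linepath (w 1) (w 2) (1/2) = vector [0, 0]"
    by (simp add: linepath_def w_def vec_eq_iff forall_2)
  have altitude: "dist (w 0) (vector [0, 0]) = h"
    using hpos by (simp add: w_def dist_vec_def L2_set_def sum_2 dist_real_def)
  have less3: "k = 0 \<or> k = 1 \<or> k = 2" if "k < 3" for k :: nat
    using that by linarith
  have "d (G 0 0) (G 1 (1/2)) \<le>
      dist (linepath (w 0) (w ((0 + 1) mod 3)) 0) (linepath (w 1) (w ((1 + 1) mod 3)) (1/2))"
  proof (rule comparison[where v = v])
    show "geodesic (G k) \<and> G k 0 = v k \<and> G k 1 = v ((k + 1) mod 3)" if "k < 3" for k
      using less3[OF that] a b g by (auto simp: G_def v_def p_def q_def)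
    show "dist (w k) (w ((k + 1) mod 3)) = d (v k) (v ((k + 1) mod 3))" if "k < 3" for k
      using less3[OF that] w m by (auto simp: v_def c_def numeral_2_eq_2)
  qed auto
  then have "d y (g (1/2)) \<le> h"
    using mid altitude a by (simp add: G_def linepath_0' numeral_2_eq_2)
  then have "(d y (g (1/2)))\<^sup>2 \<le> h\<^sup>2" by (intro power_mono) auto
  then show ?thesis using h2 by (simp add: m_def c_def p_def q_def)
qed

lemma geodesic_nearest_point_unique:
  assumes \<gamma>: "geodesic \<gamma>" and y: "y \<in> M"
    and p: "p \<in> \<gamma> ` {0..1}" "\<forall>q\<in>\<gamma> ` {0..1}. d y p \<le> d y q"
    and p': "p' \<in> \<gamma> ` {0..1}" "\<forall>q\<in>\<gamma> ` {0..1}. d y p' \<le> d y q"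
  shows "p = p'"
proof -
  obtain s t where s: "s \<in> {0..1}" "p = \<gamma> s" and t: "t \<in> {0..1}" "p' = \<gamma> t"
    using p(1) p'(1) by blast
  define g where "g = (\<lambda>r. \<gamma> (linepath s t r))"
  have g: "geodesic g" unfolding g_def by (rule geodesic_subpath) (use \<gamma> s t in auto)
  have g01: "g 0 = p" "g 1 = p'"
    using s t by (auto simp: g_def linepath_0' linepath_1')
  have eq: "d y p = d y p'" using p p' by (meson order_antisym)
  have "linepath s t (1/2) \<in> {0..1}" using s t by (simp add: linepath_def)
  then have "d y p \<le> d y (g (1/2))" using p(2) by (simp add: g_def)
  then have "(d y p)\<^sup>2 \<le> (d y (g (1/2)))\<^sup>2" by (intro power_mono) auto
  also have "\<dots> \<le> (d y p)\<^sup>2 - (d p p')\<^sup>2 / 4"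
    using midpoint_of_equidistant_points[OF y g] eq g01 by simp
  finally have "d p p' = 0" by simp
  then show ?thesis
    using geodesic_in_space[OF \<gamma>] s t by (metis zero)
qed

lemma metric_projection_nearest:
  assumes \<gamma>: "geodesic \<gamma>" and y: "y \<in> M"
  shows "metric_projection \<gamma> y \<in> \<gamma> ` {0..1} \<and>
    (\<forall>q\<in>\<gamma> ` {0..1}. d y (metric_projection \<gamma> y) \<le> d y q)"
proof -
  have "\<exists>!p. p \<in> \<gamma> ` {0..1} \<and> (\<forall>q\<in>\<gamma> ` {0..1}. d y p \<le> d y q)"
    using geodesic_nearest_point_exists[OF \<gamma> y] geodesic_nearest_point_unique[OF \<gamma> y] by blast
  then show ?thesis
    unfolding metric_projection_def by (rule theI')
qed

lemma metric_projection_in_space: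
  "geodesic \<gamma> \<Longrightarrow> y \<in> M \<Longrightarrow> metric_projection \<gamma> y \<in> M"
  using metric_projection_nearest[of \<gamma> y] geodesic_in_space[of \<gamma>] by auto

lemma metric_projection_le:
  "geodesic \<gamma> \<Longrightarrow> y \<in> M \<Longrightarrow> t \<in> {0..1} \<Longrightarrow> d y (metric_projection \<gamma> y) \<le> d y (\<gamma> t)"
  using metric_projection_nearest[of \<gamma> y] by simp

section \<open>Weak neighbourhoods and metric balls\<close>

lemma mball_subset_weak_nbhd:
  assumes F: "F \<subseteq> geodesics_from x"
  shows "mball x (\<epsilon> / 2) \<subseteq> weak_nbhd x \<epsilon> F"
proof
  fix y assume "y \<in> mball x (\<epsilon> / 2)"
  then have x: "x \<in> M" and y: "y \<in> M" and xy: "d x y < \<epsilon> / 2" by auto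
  have "d x (metric_projection \<gamma> y) < \<epsilon>" if "\<gamma> \<in> F" for \<gamma>
  proof -
    have \<gamma>: "geodesic \<gamma>" "\<gamma> 0 = x" using F that by (auto simp: geodesics_from_def)
    have "d y (metric_projection \<gamma> y) \<le> d y x"
      using metric_projection_le[OF \<gamma>(1) y, of 0] \<gamma>(2) by simp
    then show ?thesis
      using triangle[OF x y metric_projection_in_space[OF \<gamma>(1) y]] xy by (simp add: commute)
  qed
  then show "y \<in> weak_nbhd x \<epsilon> F" using y by (simp add: weak_nbhd_def)
qed

text \<open>
  The endpoint \<open>\<gamma> 1\<close> is closer to \<open>y\<close> than \<open>x\<close> is, by at least \<open>d x z - d z (\<gamma> 1)\<close>, and the
  projection is at least as close to \<open>y\<close> as that endpoint; so it is at least that far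
  from \<open>x\<close>.  The bound is independent of how far \<open>y\<close> is, which lets finitely many
  geodesics control all \<open>y\<close> outside a ball.
\<close>

lemma far_point_has_far_projection:
  assumes \<gamma>: "\<gamma> \<in> geodesics_from x" and x: "x \<in> M" and y: "y \<in> M" and z: "z \<in> M"
    and between: "d z y = d x y - d x z"
  shows "d x z - d z (\<gamma> 1) \<le> d x (metric_projection \<gamma> y)"
proof -
  have g: "geodesic \<gamma>" using \<gamma> by (simp add: geodesics_from_def)
  let ?p = "metric_projection \<gamma> y"
  have "d x y - d x ?p \<le> d y ?p"
    using triangle[OF x metric_projection_in_space[OF g y] y] by (simp add: commute)
  also have "\<dots> \<le> d y (\<gamma> 1)" using metric_projection_le[OF g y] by simp
  also have "\<dots> \<le> d z y + d z (\<gamma> 1)"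
    using triangle[OF y z geodesic_in_space[OF g, of 1]] by (simp add: commute)
  finally show ?thesis using between by simp
qed

lemma weak_nbhd_subset_mball_if_locally_compact:
  assumes lc: "locally_compact_space mtopology" and x: "x \<in> M" and r: "0 < r"
  shows "\<exists>\<epsilon>>0. \<exists>F. finite F \<and> F \<subseteq> geodesics_from x \<and> weak_nbhd x \<epsilon> F \<subseteq> mball x r"
proof -
  obtain U K where U: "openin mtopology U" "x \<in> U" "U \<subseteq> K" and K: "compactin mtopology K"
    using lc x unfolding locally_compact_space_def by auto
  obtain r0 where r0: "0 < r0" "mball x r0 \<subseteq> K"
    using U unfolding openin_mtopology by blast
  \<comment> \<open>half of the radius, so that points at distance exactly \<open>\<rho>\<close> from \<open>x\<close> lie in \<open>K\<close>\<close>
  define \<rho> where "\<rho> = min r r0 / 2"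
  have \<rho>: "0 < \<rho>" "\<rho> < r" "\<rho> < r0" using r r0 by (auto simp: \<rho>_def)
  obtain T where T: "finite T" "T \<subseteq> K" "K \<subseteq> (\<Union>q\<in>T. mball q (\<rho> / 2))"
    using compactin_imp_mtotally_bounded[OF K] \<rho>(1) unfolding mtotally_bounded_def
    by (metis half_gt_zero)
  have TM: "T \<subseteq> M" using T(2) compactin_subset_topspace[OF K] by auto
  have "\<exists>\<gamma>. \<gamma> \<in> geodesics_from x \<and> \<gamma> 1 = q" if "q \<in> T" for q
    using geodesic_exists[OF x, of q] TM that by (auto simp: geodesics_from_def)
  then obtain \<Gamma> where \<Gamma>: "\<And>q. q \<in> T \<Longrightarrow> \<Gamma> q \<in> geodesics_from x \<and> \<Gamma> q 1 = q"
    by metis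
  have "y \<in> mball x r" if y: "y \<in> weak_nbhd x (\<rho> / 2) (\<Gamma> ` T)" for y
  proof (rule ccontr)
    assume "y \<notin> mball x r"
    moreover have yM: "y \<in> M" using y by (simp add: weak_nbhd_def)
    ultimately have far: "\<rho> \<le> d x y" using x \<rho> by auto
    obtain \<alpha> where \<alpha>: "geodesic \<alpha>" "\<alpha> 0 = x" "\<alpha> 1 = y" using geodesic_exists[OF x yM] by blast
    obtain z where z: "z \<in> M" "d x z = \<rho>" "d z y = d x y - \<rho>"
      using geodesic_point_at_distance[OF \<alpha>(1) \<rho>(1)] far \<alpha> by auto
    then have "z \<in> K" using r0(2) x \<rho> by auto
    then obtain q where q: "q \<in> T" "d z q < \<rho> / 2" using T(3) by (auto simp: commute)
    have "\<rho> / 2 < d x (metric_projection (\<Gamma> q) y)"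
      using far_point_has_far_projection[OF _ x yM z(1), of "\<Gamma> q"] \<Gamma>[OF q(1)] q(2) z by auto
    moreover have "d x (metric_projection (\<Gamma> q) y) < \<rho> / 2"
      using y q(1) by (simp add: weak_nbhd_def)
    ultimately show False by simp
  qed
  then have "finite (\<Gamma> ` T) \<and> \<Gamma> ` T \<subseteq> geodesics_from x \<and> weak_nbhd x (\<rho> / 2) (\<Gamma> ` T) \<subseteq> mball x r"
    using T(1) \<Gamma> by auto
  then show ?thesis using \<rho>(1) half_gt_zero by blast
qed

lemma weak_topology_eq_mtopology:
  assumes lc: "locally_compact_space mtopology"
  shows "weak_topology = mtopology"
proof -
  have "weakly_open U \<longleftrightarrow> openin mtopology U" for U
  proof
    assume U: "weakly_open U"
    have "\<exists>r>0. mball x r \<subseteq> U" if "x \<in> U" for x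
    proof -
      have "\<exists>\<epsilon>>0. \<exists>F. finite F \<and> F \<subseteq> geodesics_from x \<and> weak_nbhd x \<epsilon> F \<subseteq> U"
        using U that by (simp add: weakly_open_def)
      then obtain \<epsilon> F where \<epsilon>: "\<epsilon> > 0" and F: "F \<subseteq> geodesics_from x" "weak_nbhd x \<epsilon> F \<subseteq> U"
        by auto
      have "mball x (\<epsilon> / 2) \<subseteq> U" using mball_subset_weak_nbhd[OF F(1)] F(2) by (rule order_trans)
      then show ?thesis using half_gt_zero[OF \<epsilon>] by blast
    qed
    then show "openin mtopology U"
      using U by (simp add: openin_mtopology weakly_open_def)
  next
    assume U: "openin mtopology U"
    have "\<exists>\<epsilon>>0. \<exists>F. finite F \<and> F \<subseteq> geodesics_from x \<and> weak_nbhd x \<epsilon> F \<subseteq> U" if "x \<in> U" for x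
    proof -
      have x: "x \<in> M" using U that by (auto simp: openin_mtopology)
      obtain r where r: "0 < r" "mball x r \<subseteq> U"
        using U \<open>x \<in> U\<close> by (auto simp: openin_mtopology)
      show ?thesis
        using weak_nbhd_subset_mball_if_locally_compact[OF lc x r(1)] order_trans[OF _ r(2)] by metis
    qed
    then show "weakly_open U"
      using U by (simp add: openin_mtopology weakly_open_def)
  qed
  then show ?thesis by (simp add: topology_eq openin_weak_topology)
qed

end

theorem theorem8:
  fixes H :: "'a set" and d :: "'a \<Rightarrow> 'a \<Rightarrow> real"
  assumes "Hadamard_space H d"
    and "locally_compact_space (Metric_space.mtopology H d)"
  shows "Metric_space.weak_topology H d = Metric_space.mtopology H d"
proof -
  interpret Hadamard_space H d by (rule assms(1))
  show ?thesis using assms(2) by (rule weak_topology_eq_mtopology)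
qed

end
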